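(* Let $(\mathfrak g,J)$ be a Lie algebra with a complex structure and suppose that there exists a 2-cocycle $\theta\in Z^2(\mathfrak g,\mathfrak g^* )$ for the Chevalley–Eilenberg complex defined by the coadjoint representation of $\mathfrak g$ such that for all $x,y,z\in\mathfrak g$ $$\theta(x,y)z=\theta(Jx,Jy)z+\theta(Jy,Jz)x+\theta(Jz,Jx)y.$$ Define on the vector space $T^*_\theta\mathfrak g=\mathfrak g\oplus\mathfrak g^*$ the bilinear form $\varphi(x+f,y+g)=f(y)+g(x)$ and the bracket $$[x+f,y+g]_T=[x,y]+\theta(x,y)+f\circ\mathrm{ad}(y)-g\circ\mathrm{ad}(x),$$ for all $x,y\in\mathfrak g$, $f,g\in\mathfrak g^*$, where $\mathrm{ad}(x)y=[x,y]$, and let $J_T$ be defined by $J_T(x+f)=Jx-f\circ J$. Then the triple $(T^*_\theta\mathfrak g,J_T,\varphi)$ is a pseudo-Hermitian quadratic Lie algebra.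
   Context: All Lie algebras are real. A complex structure on a Lie algebra $\mathfrak g$ is a linear map $J:\mathfrak g\to\mathfrak g$ with $J^2=-I$ and $[x,y]+J[Jx,y]+J[x,Jy]-[Jx,Jy]=0$ for all $x,y$. A pseudo-Hermitian quadratic Lie algebra is a triple $(\mathfrak g,J,\varphi)$ where $J$ is a complex structure and $\varphi$ is a non-degenerate symmetric bilinear form with $\varphi([x,y],z)+\varphi(y,[x,z])=0$ and $\varphi(Jx,Jy)=\varphi(x,y)$ for all $x,y,z$. The coadjoint representation is $x\cdot f=-f\circ\mathrm{ad}(x)$; a 2-cocycle $\theta\in Z^2(\mathfrak g,\mathfrak g^* )$ is a skewsymmetric bilinear map $\theta:\mathfrak g\times\mathfrak g\to\mathfrak g^*$ with $x\cdot\theta(y,z)+y\cdot\theta(z,x)+z\cdot\theta(x,y)-\theta([x,y],z)-\theta([y,z],x)-\theta([z,x],y)=0$ for all $x,y,z$. The notation $\theta(x,y)z$ means $\theta(x,y)(z)$. *)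

theory Defs
  imports "HOL-Analysis.Analysis"
begin

text \<open>The algebraic dual of a real vector space, as a type.\<close>

typedef (overloaded) 'a dual = "{f :: 'a::real_vector \<Rightarrow> real. linear f}"
  morphisms ev Dual
  by (auto intro: linear_zero)

setup_lifting type_definition_dual

instantiation dual :: (real_vector) real_vector
begin

lift_definition zero_dual :: "'a dual" is "\<lambda>_. 0"
  by (rule linear_zero)

lift_definition plus_dual :: "'a dual \<Rightarrow> 'a dual \<Rightarrow> 'a dual" is "\<lambda>f g x. f x + g x"
  by (rule linear_compose_add)

lift_definition minus_dual :: "'a dual \<Rightarrow> 'a dual \<Rightarrow> 'a dual" is "\<lambda>f g x. f x - g x"
  by (rule linear_compose_sub)

lift_definition uminus_dual :: "'a dual \<Rightarrow> 'a dual" is "\<lambda>f x. - f x"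
  by (rule linear_compose_neg)

lift_definition scaleR_dual :: "real \<Rightarrow> 'a dual \<Rightarrow> 'a dual" is "\<lambda>c f x. c *\<^sub>R f x"
  by (rule linear_compose_scale_right)

instance
  by standard (transfer; simp add: fun_eq_iff algebra_simps)+

end

text \<open>Composition \<open>f \<circ> T\<close> of a functional with an endomorphism. It is meaningful
  only for linear \<open>T\<close>, since otherwise \<open>f \<circ> T\<close> need not lie in the dual.\<close>

definition dual_comp :: "'a::real_vector dual \<Rightarrow> ('a \<Rightarrow> 'a) \<Rightarrow> 'a dual" (infixl "\<circ>\<^sub>d" 75)
  where "f \<circ>\<^sub>d T = Dual (ev f \<circ> T)"

lemma ev_dual_comp: "linear T \<Longrightarrow> ev (f \<circ>\<^sub>d T) = ev f \<circ> T"
  unfolding dual_comp_def using ev[of f] by (simp add: Dual_inverse linear_compose)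

definition lie_algebra :: "('a::real_vector \<Rightarrow> 'a \<Rightarrow> 'a) \<Rightarrow> bool"
  where "lie_algebra br \<longleftrightarrow>
    bilinear br \<and>
    (\<forall>x. br x x = 0) \<and>
    (\<forall>x y z. br x (br y z) + br y (br z x) + br z (br x y) = 0)"

definition complex_structure :: "('a::real_vector \<Rightarrow> 'a \<Rightarrow> 'a) \<Rightarrow> ('a \<Rightarrow> 'a) \<Rightarrow> bool"
  where "complex_structure br J \<longleftrightarrow>
    linear J \<and>
    (\<forall>x. J (J x) = - x) \<and>
    (\<forall>x y. br x y + J (br (J x) y) + J (br x (J y)) - br (J x) (J y) = 0)"

definition pseudo_Hermitian_quadratic ::
    "('a::real_vector \<Rightarrow> 'a \<Rightarrow> 'a) \<Rightarrow> ('a \<Rightarrow> 'a) \<Rightarrow> ('a \<Rightarrow> 'a \<Rightarrow> real) \<Rightarrow> bool"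
  where "pseudo_Hermitian_quadratic br J \<phi> \<longleftrightarrow>
    lie_algebra br \<and>
    complex_structure br J \<and>
    bilinear \<phi> \<and>
    (\<forall>x y. \<phi> x y = \<phi> y x) \<and>
    (\<forall>x. (\<forall>y. \<phi> x y = 0) \<longrightarrow> x = 0) \<and>
    (\<forall>x y z. \<phi> (br x y) z + \<phi> y (br x z) = 0) \<and>
    (\<forall>x y. \<phi> (J x) (J y) = \<phi> x y)"

text \<open>The partially applied bracket \<open>br x\<close> is \<open>ad(x)\<close>.\<close>

definition coadjoint :: "('a::real_vector \<Rightarrow> 'a \<Rightarrow> 'a) \<Rightarrow> 'a \<Rightarrow> 'a dual \<Rightarrow> 'a dual"
  where "coadjoint br x f = - (f \<circ>\<^sub>d br x)"

definition coadjoint_2cocycle ::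
    "('a::real_vector \<Rightarrow> 'a \<Rightarrow> 'a) \<Rightarrow> ('a \<Rightarrow> 'a \<Rightarrow> 'a dual) \<Rightarrow> bool"
  where "coadjoint_2cocycle br \<theta> \<longleftrightarrow>
    bilinear \<theta> \<and>
    (\<forall>x y. \<theta> x y = - \<theta> y x) \<and>
    (\<forall>x y z. coadjoint br x (\<theta> y z) + coadjoint br y (\<theta> z x) + coadjoint br z (\<theta> x y)
        - \<theta> (br x y) z - \<theta> (br y z) x - \<theta> (br z x) y = 0)"

text \<open>The data on \<open>\<gg> \<oplus> \<gg>\<^sup>*\<close>, realised as the product type, with \<open>(x, f)\<close> for \<open>x + f\<close>.\<close>

definition T_bracket :: "('a::real_vector \<Rightarrow> 'a \<Rightarrow> 'a) \<Rightarrow> ('a \<Rightarrow> 'a \<Rightarrow> 'a dual) \<Rightarrow>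
    'a \<times> 'a dual \<Rightarrow> 'a \<times> 'a dual \<Rightarrow> 'a \<times> 'a dual"
  where "T_bracket br \<theta> = (\<lambda>(x, f) (y, g). (br x y, \<theta> x y + f \<circ>\<^sub>d br y - g \<circ>\<^sub>d br x))"

definition T_complex :: "('a::real_vector \<Rightarrow> 'a) \<Rightarrow> 'a \<times> 'a dual \<Rightarrow> 'a \<times> 'a dual"
  where "T_complex J = (\<lambda>(x, f). (J x, - (f \<circ>\<^sub>d J)))"

definition T_form :: "'a::real_vector \<times> 'a dual \<Rightarrow> 'a \<times> 'a dual \<Rightarrow> real"
  where "T_form = (\<lambda>(x, f) (y, g). ev f y + ev g x)"

end

theory Submission
  imports Defs
begin

text \<open>
  Read as the trilinear form \<open>\<theta>(x,y)z\<close>, the cochain \<open>\<theta>\<close> is invariant under cyclic permutations of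
  its arguments, because the right-hand side of the \<open>J\<close>-compatibility condition is visibly cyclic.
  This makes the form invariant on \<open>\<gg> \<oplus> \<gg>\<^sup>*\<close>: the terms in
  \<open>\<gg>\<^sup>*\<close> cancel identically, and what remains is \<open>\<theta>(x,y)z + \<theta>(x,z)y\<close>, which vanishes for a skew
  cyclic \<open>\<theta>\<close>.

  The other two substantial points concern the \<open>\<gg>\<^sup>*\<close>-components of the Jacobi identity and of the
  Nijenhuis tensor. Both split into a part linear in the functionals, which vanishes because the
  functionals are evaluated on a Jacobi sum, respectively on a value of the Nijenhuis tensor of
  \<open>J\<close>, and a part in \<open>\<theta>\<close> alone. The \<open>\<theta>\<close>-part of the Jacobi identity is the
  cocycle condition. The \<open>\<theta>\<close>-part of the Nijenhuis tensor, at \<open>z\<close>, is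
  \<open>\<theta>(x,y)z - \<theta>(Jx,Jy)z - \<theta>(x,Jy)(Jz) - \<theta>(Jx,y)(Jz)\<close>, which by cyclicity is the compatibility
  condition.

  Non-degeneracy says that linear functionals separate the points of a real vector space, which
  follows from the existence of Hamel bases.
\<close>

section \<open>Functionals on a real vector space\<close>

lemma linear_ev: "linear (ev f)"
  using ev[of f] by simp

lemmas ev_linear_simps [simp] =
  linear_add[OF linear_ev] linear_diff[OF linear_ev] linear_neg[OF linear_ev]
  linear_0[OF linear_ev] linear_scale[OF linear_ev]

lemmas ev_dual_simps [simp] =
  zero_dual.rep_eq plus_dual.rep_eq minus_dual.rep_eq uminus_dual.rep_eq scaleR_dual.rep_eq

lemma dual_eqI: "(\<And>z. ev f z = ev g z) \<Longrightarrow> f = g"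
  by (metis ev_inject ext)

lemma ev_dual_comp_apply: "linear T \<Longrightarrow> ev (f \<circ>\<^sub>d T) z = ev f (T z)"
  by (simp add: ev_dual_comp)

text \<open>A nonzero vector is an independent set, so it extends to a Hamel basis and some functional
  takes the value 1 on it.\<close>

lemma dual_separates_points:
  fixes x :: "'a::real_vector"
  assumes "\<And>f. ev f x = 0"
  shows "x = 0"
proof (rule ccontr)
  assume "x \<noteq> 0"
  then have "independent {x}"
    by simp
  then obtain g :: "'a \<Rightarrow> real" where "linear g" "g x = 1"
    using linear_independent_extend[of "{x}" "\<lambda>_. 1::real"] by auto
  then show False
    using assms[of "Dual g"] by (simp add: Dual_inverse)
qed

lemma bilinear_minus:
  assumes "bilinear h"
  shows "h (- x) y = - h x y" "h x (- y) = - h x y"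
  using assms by (simp_all add: bilinear_lneg bilinear_rneg)

lemmas bilinear_simps =
  bilinear_ladd bilinear_radd bilinear_minus bilinear_lmul bilinear_rmul

lemma bilinearI:
  assumes "\<And>x y z. h (x + y) z = h x z + h y z" "\<And>x y z. h x (y + z) = h x y + h x z"
    and "\<And>c x y. h (c *\<^sub>R x) y = c *\<^sub>R h x y" "\<And>c x y. h x (c *\<^sub>R y) = c *\<^sub>R h x y"
  shows "bilinear h"
  unfolding bilinear_def using assms by (auto intro!: linearI)

lemma lie_bracket_skew:
  assumes "lie_algebra br"
  shows "br x y = - br y x"
proof -
  have b: "bilinear br" and z: "\<And>x. br x x = 0"
    using assms by (auto simp: lie_algebra_def)
  have "br (x + y) (x + y) = br x y + br y x"
    unfolding bilinear_ladd[OF b] bilinear_radd[OF b] by (simp add: z)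
  then show ?thesis
    by (metis z eq_neg_iff_add_eq_0)
qed

section \<open>The extended bracket, form and complex structure\<close>

lemma fst_T_bracket: "fst (T_bracket br \<theta> X Y) = br (fst X) (fst Y)"
  by (simp add: T_bracket_def split: prod.split)

lemma ev_snd_T_bracket:
  assumes "bilinear br"
  shows "ev (snd (T_bracket br \<theta> X Y)) z =
    ev (\<theta> (fst X) (fst Y)) z + ev (snd X) (br (fst Y) z) - ev (snd Y) (br (fst X) z)"
proof -
  have "linear (br x)" for x
    using assms by (simp add: bilinear_def)
  then show ?thesis
    by (simp add: T_bracket_def ev_dual_comp_apply split: prod.split)
qed

lemma fst_T_complex: "fst (T_complex J X) = J (fst X)"
  by (simp add: T_complex_def split: prod.split)

lemma ev_snd_T_complex: "linear J \<Longrightarrow> ev (snd (T_complex J X)) z = - ev (snd X) (J z)"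
  by (simp add: T_complex_def ev_dual_comp_apply split: prod.split)

lemma T_form_eq: "T_form X Y = ev (snd X) (fst Y) + ev (snd Y) (fst X)"
  by (simp add: T_form_def split: prod.split)

lemma prod_dual_eqI:
  "fst X = fst Y \<Longrightarrow> (\<And>z. ev (snd X) z = ev (snd Y) z) \<Longrightarrow> X = Y"
  by (simp add: prod_eq_iff dual_eqI)

lemma bilinear_T_form: "bilinear (T_form :: 'a::real_vector \<times> 'a dual \<Rightarrow> _)"
  by (rule bilinearI) (simp_all add: T_form_eq algebra_simps)

lemma T_form_nondegenerate:
  assumes "\<And>Y. T_form X Y = 0"
  shows "X = 0"
proof (rule prod_dual_eqI)
  show "fst X = fst 0"
    using assms[of "(0, _)"] by (auto simp: T_form_eq intro: dual_separates_points)
  show "ev (snd X) z = ev (snd 0) z" for z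
    using assms[of "(z, 0)"] by (simp add: T_form_eq)
qed

lemma bilinear_T_bracket:
  assumes "bilinear br" "bilinear \<theta>"
  shows "bilinear (T_bracket br \<theta>)"
  by (rule bilinearI; rule prod_dual_eqI)
    (simp_all add: fst_T_bracket ev_snd_T_bracket assms(1) bilinear_simps[OF assms(1)]
      bilinear_simps[OF assms(2)] algebra_simps)

lemma lie_algebra_T_bracket:
  assumes lie: "lie_algebra br" and coc: "coadjoint_2cocycle br \<theta>"
  shows "lie_algebra (T_bracket br \<theta>)"
proof -
  have b: "bilinear br" and z: "\<And>x. br x x = 0"
    and jac: "\<And>x y z. br x (br y z) + br y (br z x) + br z (br x y) = 0"
    using lie by (auto simp: lie_algebra_def)
  have lin: "linear (br x)" for x
    using b by (simp add: bilinear_def)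
  have bt: "bilinear \<theta>" and skew: "\<And>x y. \<theta> x y = - \<theta> y x"
    using coc unfolding coadjoint_2cocycle_def by blast+
  have ev_skew: "ev (\<theta> x y) u = - ev (\<theta> y x) u" for x y u
    by (subst skew) simp
  have cocycle: "- ev (\<theta> y z) (br x u) - ev (\<theta> z x) (br y u) - ev (\<theta> x y) (br z u)
      + ev (\<theta> z (br x y)) u + ev (\<theta> x (br y z)) u + ev (\<theta> y (br z x)) u = 0" for x y z u
  proof -
    have "coadjoint br x (\<theta> y z) + coadjoint br y (\<theta> z x) + coadjoint br z (\<theta> x y)
        - \<theta> (br x y) z - \<theta> (br y z) x - \<theta> (br z x) y = 0"
      using coc unfolding coadjoint_2cocycle_def by blast
    from arg_cong[OF this, of "\<lambda>f. ev f u"] show ?thesis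
      using ev_skew[of "br x y" z u] ev_skew[of "br y z" x u] ev_skew[of "br z x" y u]
      by (simp add: coadjoint_def ev_dual_comp_apply lin)
  qed
  \<comment> \<open>This is \<open>ad([x,y]) = ad(x) ad(y) - ad(y) ad(x)\<close> under a functional: it kills the terms of the
    Jacobi sum that do not involve \<open>\<theta>\<close>.\<close>
  have ad: "ev f (br (br x y) u) = ev f (br x (br y u)) - ev f (br y (br x u))" for f x y u
  proof -
    have "br (br x y) u = br x (br y u) - br y (br x u)"
      using jac[of x y u] lie_bracket_skew[OF lie, of u "br x y"]
        lie_bracket_skew[OF lie, of u x] bilinear_minus(2)[OF b, of y "br x u"]
      by (simp add: algebra_simps)
    then show ?thesis
      by simp
  qed
  have "T_bracket br \<theta> X X = 0" for X
    using ev_skew[of "fst X" "fst X"]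
    by (intro prod_dual_eqI) (simp_all add: fst_T_bracket ev_snd_T_bracket b z)
  moreover have "T_bracket br \<theta> X (T_bracket br \<theta> Y Z) + T_bracket br \<theta> Y (T_bracket br \<theta> Z X)
      + T_bracket br \<theta> Z (T_bracket br \<theta> X Y) = 0" for X Y Z
  proof (rule prod_dual_eqI, goal_cases)
    case 1
    show ?case
      by (simp add: fst_T_bracket jac)
  next
    case (2 u)
    show ?case
      using cocycle[where x = "fst X" and y = "fst Y" and z = "fst Z" and u = u]
      by (simp add: fst_T_bracket ev_snd_T_bracket b ad)
  qed
  ultimately show ?thesis
    using bilinear_T_bracket[OF b bt] by (simp add: lie_algebra_def)
qed

section \<open>Consequences of cyclicity\<close>

text \<open>For cyclic skew \<open>\<theta>\<close>, the trilinear form \<open>\<theta>(x,y)z\<close> is alternating, hence skew in \<open>y, z\<close>.\<close>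

lemma T_form_invariant:
  assumes lie: "lie_algebra br"
    and skew: "\<And>x y. \<theta> x y = - \<theta> y x"
    and cyclic: "\<And>x y z. ev (\<theta> x y) z = ev (\<theta> y z) x"
  shows "T_form (T_bracket br \<theta> X Y) Z + T_form Y (T_bracket br \<theta> X Z) = 0"
proof -
  have b: "bilinear br"
    using lie by (simp add: lie_algebra_def)
  have "ev (\<theta> (fst X) (fst Z)) (fst Y) = - ev (\<theta> (fst X) (fst Y)) (fst Z)"
    by (subst skew) (simp add: cyclic[of "fst X" "fst Y"] cyclic[of "fst Y" "fst Z"])
  moreover have "ev (snd X) (br (fst Z) (fst Y)) = - ev (snd X) (br (fst Y) (fst Z))"
    by (subst lie_bracket_skew[OF lie]) simp
  ultimately show ?thesis
    by (simp add: T_form_eq fst_T_bracket ev_snd_T_bracket b)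
qed

lemma complex_structure_T_complex:
  assumes lie: "lie_algebra br" and cs: "complex_structure br J"
    and cyclic: "\<And>x y z. ev (\<theta> x y) z = ev (\<theta> y z) x"
    and compat: "\<And>x y z. ev (\<theta> x y) z =
      ev (\<theta> (J x) (J y)) z + ev (\<theta> (J y) (J z)) x + ev (\<theta> (J z) (J x)) y"
  shows "complex_structure (T_bracket br \<theta>) (T_complex J)"
proof -
  have b: "bilinear br"
    using lie by (simp add: lie_algebra_def)
  have J: "linear J" and JJ: "\<And>x. J (J x) = - x"
    and nij: "\<And>x y. br x y + J (br (J x) y) + J (br x (J y)) - br (J x) (J y) = 0"
    using cs by (auto simp: complex_structure_def)
  have ev_nij: "ev f (br x y) + ev f (J (br (J x) y)) + ev f (J (br x (J y)))
      - ev f (br (J x) (J y)) = 0" for f x y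
    using arg_cong[OF nij[of x y], of "ev f"] by simp
  have theta: "ev (\<theta> x y) z - ev (\<theta> (J x) y) (J z) - ev (\<theta> x (J y)) (J z)
      - ev (\<theta> (J x) (J y)) z = 0" for x y z
    using compat[of x y z] cyclic[of x "J y" "J z"] cyclic[of "J z" "J x" y] by simp
  have "linear (T_complex J)"
    by (rule linearI; rule prod_dual_eqI)
      (simp_all add: fst_T_complex ev_snd_T_complex J linear_add[OF J] linear_scale[OF J])
  moreover have "T_complex J (T_complex J X) = - X" for X
    by (rule prod_dual_eqI) (simp_all add: fst_T_complex ev_snd_T_complex J JJ)
  moreover have "T_bracket br \<theta> X Y + T_complex J (T_bracket br \<theta> (T_complex J X) Y)
      + T_complex J (T_bracket br \<theta> X (T_complex J Y))
      - T_bracket br \<theta> (T_complex J X) (T_complex J Y) = 0" for X Y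
  proof (rule prod_dual_eqI, goal_cases)
    case 1
    show ?case
      by (simp add: fst_T_bracket fst_T_complex nij)
  next
    case (2 z)
    \<comment> \<open>The functional part of \<open>X\<close> gets evaluated at the Nijenhuis tensor of \<open>(fst Y, z)\<close>, that of
      \<open>Y\<close> at minus the Nijenhuis tensor of \<open>(fst X, z)\<close>.\<close>
    show ?case
      using theta[of "fst X" "fst Y" z] ev_nij[of "snd X" "fst Y" z] ev_nij[of "snd Y" "fst X" z]
      by (simp add: fst_T_bracket ev_snd_T_bracket fst_T_complex ev_snd_T_complex b J)
  qed
  ultimately show ?thesis
    by (simp add: complex_structure_def)
qed

theorem proposition1p3:
  fixes br :: "'a::real_vector \<Rightarrow> 'a \<Rightarrow> 'a"
    and J :: "'a \<Rightarrow> 'a"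
    and \<theta> :: "'a \<Rightarrow> 'a \<Rightarrow> 'a dual"
  assumes "lie_algebra br"
    and "complex_structure br J"
    and "coadjoint_2cocycle br \<theta>"
    and "\<And>x y z. ev (\<theta> x y) z =
           ev (\<theta> (J x) (J y)) z + ev (\<theta> (J y) (J z)) x + ev (\<theta> (J z) (J x)) y"
  shows "pseudo_Hermitian_quadratic (T_bracket br \<theta>) (T_complex J) T_form"
proof -
  have cyclic: "ev (\<theta> x y) z = ev (\<theta> y z) x" for x y z
    using assms(4)[of x y z] assms(4)[of y z x] by linarith
  have skew: "\<theta> x y = - \<theta> y x" for x y
    using assms(3) unfolding coadjoint_2cocycle_def by blast
  have J: "linear J" and JJ: "\<And>x. J (J x) = - x"
    using assms(2) by (auto simp: complex_structure_def)
  have "T_form X Y = T_form Y X" for X Y :: "'a \<times> 'a dual"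
    by (simp add: T_form_eq)
  moreover have "T_form (T_complex J X) (T_complex J Y) = T_form X Y" for X Y
    by (simp add: T_form_eq fst_T_complex ev_snd_T_complex J JJ)
  ultimately show ?thesis
    unfolding pseudo_Hermitian_quadratic_def
    using lie_algebra_T_bracket[OF assms(1,3)]
      complex_structure_T_complex[where \<theta> = \<theta>, OF assms(1,2) cyclic assms(4)]
      bilinear_T_form T_form_nondegenerate
      T_form_invariant[where \<theta> = \<theta>, OF assms(1) skew cyclic]
    by blast
qed

end
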